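(* Let $\tau,\tau'$ be tasks scheduled dynamically by earliest deadline first, where jobs with equal absolute deadline are served in order of their request times. Fix a job of $\tau$ with request time $t^r_\tau$ and absolute deadline $D_\tau$. Then for every $t\in\mathbb R$ and interval $\Delta_{a,b}=[t_a,t_b)$, the interference request bound, i.e. the total execution time of the jobs of $\tau'$ requested in $[t_a,t_b)$ and no later than $t$ that interfere with the considered job of $\tau$, is $$\rho^{D_{\tau'}\le D_\tau}_{\tau,\tau'}(t,\Delta_{a,b})=\int_{-\infty}^{t}\sum_{e\in E_{\tau'}}\sum_{n=0}^{k-1}\delta(t'-a_e-np_e)\,C^n_{\tau',e}\,\big[H^l(D_\tau-D_{\tau',e,n})+\delta_{D_{\tau',e,n},D_\tau}H^u(t^r_\tau-t^r_{\tau',e,n})\big]H^u(t'-t_a)H^l(t_b-t')\,dt',$$ where $t^r_{\tau',e,n}=a_e+np_e$ and $D_{\tau',e,n}$ are the request time and absolute deadline of job $(e,n)$ of $\tau'$.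
   Context: A task $\tau'$ has a finite event list $E_{\tau'}$ of event tuples $e$ with period $p_e\ge0$ and minimal distance $a_e\ge0$, and a bound $k\in\mathbb N\cup\{\infty\}$ (all $p_e>0$ if $k=\infty$). Its jobs are the pairs $(e,n)$ with $e\in E_{\tau'}$, $0\le n\le k-1$ (all $n\ge 0$ if $k=\infty$); job $(e,n)$ is requested at time $a_e+np_e$, has execution time $C^n_{\tau',e}\ge0$, and has absolute deadline $D_{\tau',e,n}=a_e+np_e+d_{\tau',e}$, where $d_{\tau',e}$ is its relative deadline. A job of $\tau'$ interferes with the considered job of $\tau$ iff its absolute deadline is strictly smaller than $D_\tau$, or it equals $D_\tau$ and the job of $\tau'$ is requested no later than the considered job. $\delta(t'-s)\,dt'$ is the unit point mass at $s$; $\int_{-\infty}^t$ is over $(-\infty,t]$, including a point mass at $t$; $\delta_{x,y}$ with two indices is the Kronecker delta. $H^u(x)=1$ for $x\ge0$, $0$ for $x<0$; $H^l(x)=1$ for $x>0$, $0$ for $x\le0$. *)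

theory Defs
  imports "HOL-Probability.Probability"
begin

text \<open>
  The event list of a task may contain the same tuple several times, so an event of a task is
  addressed by its position in the list.  A job is a pair of such a position and an activation
  number.  The execution times and relative deadlines are indexed in the same way.
\<close>

record event =
  period :: real
  min_distance :: real

record task =
  event_list :: "event list"
  job_bound :: enat
  exec :: "nat \<Rightarrow> nat \<Rightarrow> real"
  rel_deadline :: "nat \<Rightarrow> real"

definition jobs :: "task \<Rightarrow> (nat \<times> nat) set" where
  "jobs \<tau> = {(e, n). e < length (event_list \<tau>) \<and> enat n < job_bound \<tau>}"

definition exec_time :: "task \<Rightarrow> nat \<times> nat \<Rightarrow> real" where
  "exec_time \<tau> = (\<lambda>(e, n). exec \<tau> e n)"

definition request_time :: "task \<Rightarrow> nat \<times> nat \<Rightarrow> real" where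
  "request_time \<tau> =
     (\<lambda>(e, n). min_distance (event_list \<tau> ! e) + real n * period (event_list \<tau> ! e))"

definition abs_deadline :: "task \<Rightarrow> nat \<times> nat \<Rightarrow> real" where
  "abs_deadline \<tau> j = request_time \<tau> j + rel_deadline \<tau> (fst j)"

definition valid_task :: "task \<Rightarrow> bool" where
  "valid_task \<tau> \<longleftrightarrow>
     (\<forall>ev \<in> set (event_list \<tau>). 0 \<le> period ev \<and> 0 \<le> min_distance ev) \<and>
     (job_bound \<tau> = \<infinity> \<longrightarrow> (\<forall>ev \<in> set (event_list \<tau>). 0 < period ev)) \<and>
     (\<forall>j \<in> jobs \<tau>. 0 \<le> exec_time \<tau> j)"

text \<open>Job \<open>j'\<close> of \<open>\<tau>'\<close> interferes with job \<open>j\<close> of \<open>\<tau>\<close>.\<close>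

definition edf_interferes :: "task \<Rightarrow> nat \<times> nat \<Rightarrow> task \<Rightarrow> nat \<times> nat \<Rightarrow> bool" where
  "edf_interferes \<tau> j \<tau>' j' \<longleftrightarrow>
     abs_deadline \<tau>' j' < abs_deadline \<tau> j \<or>
     (abs_deadline \<tau>' j' = abs_deadline \<tau> j \<and> request_time \<tau>' j' \<le> request_time \<tau> j)"

text \<open>
  For a valid task \<open>\<tau>'\<close> the set of jobs summed over is finite, even if \<open>\<tau>'\<close> has infinitely many jobs.
\<close>

definition interference_request_bound ::
  "task \<Rightarrow> nat \<times> nat \<Rightarrow> task \<Rightarrow> real \<Rightarrow> real \<Rightarrow> real \<Rightarrow> real" where
  "interference_request_bound \<tau> j \<tau>' t ta tb =
     (\<Sum>j' \<in> {j' \<in> jobs \<tau>'. request_time \<tau>' j' \<in> {ta..<tb} \<and> request_time \<tau>' j' \<le> t \<and>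
                         edf_interferes \<tau> j \<tau>' j'}. exec_time \<tau>' j')"

definition heaviside_u :: "real \<Rightarrow> real" where
  "heaviside_u x = (if x \<ge> 0 then 1 else 0)"

definition heaviside_l :: "real \<Rightarrow> real" where
  "heaviside_l x = (if x > 0 then 1 else 0)"

definition kronecker :: "real \<Rightarrow> real \<Rightarrow> real" where
  "kronecker x y = (if x = y then 1 else 0)"

text \<open>
  A generalised integrand \<open>\<delta>(t' - s) f(t') dt'\<close> is the unit point mass at \<open>s\<close> with density \<open>f\<close>.
  It is only meant for \<open>f \<ge> 0\<close>, as \<open>ennreal\<close> truncates negative values.
  A sum of generalised integrands is the sum of the corresponding measures.
\<close>

definition weighted_delta :: "real \<Rightarrow> (real \<Rightarrow> real) \<Rightarrow> real measure" where
  "weighted_delta s f = density (return borel s) (\<lambda>x. ennreal (f x))"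

definition sum_measure :: "'i set \<Rightarrow> ('i \<Rightarrow> real measure) \<Rightarrow> real measure" where
  "sum_measure I M =
     measure_of UNIV (sets borel) (\<lambda>A. \<integral>\<^sup>+ i. emeasure (M i) A \<partial>count_space I)"

lemma sets_sum_measure [simp]: "sets (sum_measure I M) = sets borel"
  unfolding sum_measure_def by (metis sets.sets_measure_of_eq space_borel)

lemma emeasure_sum_measure:
  assumes "\<And>i. i \<in> I \<Longrightarrow> sets (M i) = sets borel" and A: "A \<in> sets borel"
  shows "emeasure (sum_measure I M) A = (\<integral>\<^sup>+ i. emeasure (M i) A \<partial>count_space I)"
proof (rule emeasure_measure_of[OF sum_measure_def])
  show "sets borel \<subseteq> Pow (UNIV :: real set)" by simp
  show "A \<in> sets (sum_measure I M)" using A by simp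
  show "positive (sets (sum_measure I M)) (\<lambda>A. \<integral>\<^sup>+ i. emeasure (M i) A \<partial>count_space I)"
    by (simp add: positive_def)
  show "countably_additive (sets (sum_measure I M))
          (\<lambda>A. \<integral>\<^sup>+ i. emeasure (M i) A \<partial>count_space I)"
  proof (rule countably_additiveI)
    fix F :: "nat \<Rightarrow> real set"
    assume F: "range F \<subseteq> sets (sum_measure I M)" "disjoint_family F"
    have "(\<Sum>k. \<integral>\<^sup>+ i. emeasure (M i) (F k) \<partial>count_space I) =
          (\<integral>\<^sup>+ i. (\<Sum>k. emeasure (M i) (F k)) \<partial>count_space I)"
      by (subst nn_integral_suminf) auto
    also have "\<dots> = (\<integral>\<^sup>+ i. emeasure (M i) (\<Union>k. F k) \<partial>count_space I)"
      using F assms(1) by (intro nn_integral_cong suminf_emeasure) auto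
    finally show "(\<Sum>k. \<integral>\<^sup>+ i. emeasure (M i) (F k) \<partial>count_space I) =
          (\<integral>\<^sup>+ i. emeasure (M i) (\<Union>k. F k) \<partial>count_space I)" .
  qed
qed

end

theory Submission
  imports Defs
begin

text \<open>The integral of 1 over \<open>{..t}\<close> is the mass that the sum of point masses
  gives to \<open>{..t}\<close>. Each job contributes its density evaluated at its own request time
  if that time is at most \<open>t\<close>, and 0 otherwise
  (\<open>emeasure_weighted_delta\<close>). There the bracket is the 0/1 indicator of interference
  (\<open>interference_weight\<close>), and the two remaining Heaviside factors cut out the interval
  from \<open>ta\<close> (included) to \<open>tb\<close> (excluded). So exactly the jobs counted by
  the bound keep their execution time. Only finitely many jobs are requested by time
  \<open>t\<close> (\<open>finite_activations_until\<close>), which turns the possibly infinite sum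
  into the finite real sum.\<close>

lemma sets_weighted_delta [simp]: "sets (weighted_delta s f) = sets borel"
  by (simp add: weighted_delta_def)

lemma emeasure_weighted_delta:
  assumes "f \<in> borel_measurable borel" and "A \<in> sets borel"
  shows "emeasure (weighted_delta s f) A = ennreal (f s) * indicator A s"
  using assms by (simp add: weighted_delta_def emeasure_density nn_integral_return)

lemma finite_arithmetic_progression_le:
  fixes a p t :: real
  assumes "0 < p"
  shows "finite {n :: nat. a + real n * p \<le> t}"
proof (rule finite_subset)
  show "{n. a + real n * p \<le> t} \<subseteq> {..nat \<lfloor>(t - a) / p\<rfloor>}"
    using assms by (auto simp: le_nat_floor field_simps)
qed simp

text \<open>For a finite job bound there are only finitely many activations at all; for an infinite
  one, validity makes the period positive, so request times grow without bound.\<close>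

lemma finite_activations_until:
  assumes "valid_task \<tau>" and "e < length (event_list \<tau>)"
  shows "finite {n. enat n < job_bound \<tau> \<and> request_time \<tau> (e, n) \<le> t}"
proof (cases "job_bound \<tau>")
  case (enat k)
  then show ?thesis by simp
next
  case infinity
  then have "0 < period (event_list \<tau> ! e)"
    using assms by (simp add: valid_task_def)
  from finite_arithmetic_progression_le[OF this] show ?thesis
    by (simp add: request_time_def infinity)
qed

text \<open>The strict and the equal deadline case exclude each other, so the two summands are never
  both 1.\<close>

lemma interference_weight:
  "(heaviside_l (abs_deadline \<tau> j - abs_deadline \<tau>' j') +
    kronecker (abs_deadline \<tau>' j') (abs_deadline \<tau> j) *
      heaviside_u (request_time \<tau> j - request_time \<tau>' j')) =
   of_bool (edf_interferes \<tau> j \<tau>' j')"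
  by (auto simp: edf_interferes_def heaviside_l_def heaviside_u_def kronecker_def)

theorem corollary2:
  fixes \<tau> \<tau>' :: task and j :: "nat \<times> nat" and t ta tb :: real
  assumes "valid_task \<tau>" and "valid_task \<tau>'" and "j \<in> jobs \<tau>"
  shows "ennreal (interference_request_bound \<tau> j \<tau>' t ta tb) =
    (\<integral>\<^sup>+ t' \<in> {..t}. 1
      \<partial>sum_measure {..<length (event_list \<tau>')} (\<lambda>e. sum_measure {n. enat n < job_bound \<tau>'} (\<lambda>n.
         weighted_delta (min_distance (event_list \<tau>' ! e) + real n * period (event_list \<tau>' ! e))
           (\<lambda>t'. exec \<tau>' e n *
              (heaviside_l (abs_deadline \<tau> j - abs_deadline \<tau>' (e, n)) +
               kronecker (abs_deadline \<tau>' (e, n)) (abs_deadline \<tau> j) *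
                 heaviside_u (request_time \<tau> j - request_time \<tau>' (e, n))) *
              heaviside_u (t' - ta) * heaviside_l (tb - t')))))"
proof -
  define P where "P j' \<longleftrightarrow> request_time \<tau>' j' \<in> {ta..<tb} \<and> request_time \<tau>' j' \<le> t \<and>
    edf_interferes \<tau> j \<tau>' j'" for j'
  define N where "N e = {n. enat n < job_bound \<tau>' \<and> P (e, n)}" for e
  define W where "W e n = weighted_delta
      (min_distance (event_list \<tau>' ! e) + real n * period (event_list \<tau>' ! e))
      (\<lambda>t'. exec \<tau>' e n *
        (heaviside_l (abs_deadline \<tau> j - abs_deadline \<tau>' (e, n)) +
         kronecker (abs_deadline \<tau>' (e, n)) (abs_deadline \<tau> j) *
           heaviside_u (request_time \<tau> j - request_time \<tau>' (e, n))) *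
        heaviside_u (t' - ta) * heaviside_l (tb - t'))" for e n
  have sets_W: "sets (W e n) = sets borel" for e n
    by (simp add: W_def)
  \<comment> \<open>The three conjuncts of \<open>P\<close> come from the indicator of
    \<open>{..t}\<close>, the two Heaviside factors at the request time, and the bracket.\<close>
  have W: "emeasure (W e n) {..t} = (if P (e, n) then ennreal (exec \<tau>' e n) else 0)" for e n
    unfolding W_def interference_weight
    by (subst emeasure_weighted_delta)
      (auto simp: P_def request_time_def heaviside_u_def heaviside_l_def indicator_def)
  have fin: "finite (N e)" if "e < length (event_list \<tau>')" for e
    by (rule finite_subset[OF _ finite_activations_until[OF assms(2) that, of t]])
      (auto simp: N_def P_def)
  \<comment> \<open>Splitting the counted jobs by event matches the nesting of the two measure
    sums.\<close>
  have jobs_P: "{j' \<in> jobs \<tau>'. P j'} = Sigma {..<length (event_list \<tau>')} N"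
    by (auto simp: jobs_def N_def)
  have nonneg: "0 \<le> exec_time \<tau>' j'" if "j' \<in> {j' \<in> jobs \<tau>'. P j'}" for j'
    using assms(2) that by (auto simp: valid_task_def)
  have row: "emeasure (sum_measure {n. enat n < job_bound \<tau>'} (W e)) {..t} =
      (\<Sum>n\<in>N e. ennreal (exec_time \<tau>' (e, n)))" if "e < length (event_list \<tau>')" for e
  proof -
    have "emeasure (sum_measure {n. enat n < job_bound \<tau>'} (W e)) {..t} =
        (\<integral>\<^sup>+ n. emeasure (W e n) {..t} \<partial>count_space {n. enat n < job_bound \<tau>'})"
      by (simp add: emeasure_sum_measure sets_W)
    also have "\<dots> = (\<Sum>n\<in>N e. emeasure (W e n) {..t})"
      \<comment> \<open>All activations outside the finite set \<open>N e\<close> carry mass 0 by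
        \<open>W\<close>.\<close>
      by (rule nn_integral_count_space') (use fin[OF that] in \<open>auto simp: W N_def\<close>)
    also have "\<dots> = (\<Sum>n\<in>N e. ennreal (exec_time \<tau>' (e, n)))"
      by (rule sum.cong) (auto simp: W N_def exec_time_def)
    finally show ?thesis .
  qed
  have "(\<integral>\<^sup>+ t' \<in> {..t}. 1 \<partial>sum_measure {..<length (event_list \<tau>')}
          (\<lambda>e. sum_measure {n. enat n < job_bound \<tau>'} (W e))) =
      (\<integral>\<^sup>+ e. emeasure (sum_measure {n. enat n < job_bound \<tau>'} (W e)) {..t}
        \<partial>count_space {..<length (event_list \<tau>')})"
    by (simp add: emeasure_sum_measure)
  also have "\<dots> = (\<Sum>e<length (event_list \<tau>'). \<Sum>n\<in>N e. ennreal (exec_time \<tau>' (e, n)))"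
    by (simp add: nn_integral_count_space_finite row)
  also have "\<dots> = (\<Sum>j' \<in> Sigma {..<length (event_list \<tau>')} N. ennreal (exec_time \<tau>' j'))"
    by (subst sum.Sigma) (auto simp: fin split_def)
  \<comment> \<open>Pulling \<open>ennreal\<close> out of the sum requires nonnegative execution
    times, since it truncates negative values to 0.\<close>
  also have "\<dots> = ennreal (\<Sum>j' \<in> {j' \<in> jobs \<tau>'. P j'}. exec_time \<tau>' j')"
    unfolding jobs_P[symmetric] using nonneg by (rule sum_ennreal)
  also have "\<dots> = ennreal (interference_request_bound \<tau> j \<tau>' t ta tb)"
    by (simp add: interference_request_bound_def P_def)
  finally show ?thesis
    unfolding W_def[abs_def] by (rule sym)
qed

end
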